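(* Let $t\ge 2$ be a fixed integer. For integers $1\le s\le n-1$ let $Y=Y_{n,s}$ be the number of draws needed to collect all $n$ coupons when each draw is an independent, uniformly random $s$-subset of the $n$ coupons. (a) Let $\lambda>0$ be a constant and let $s=s(n)=n-\lambda\, n^{\frac{t-1}{t}}$, rounded to an integer (i.e. $s(n)$ is an integer with $|s(n)-(n-\lambda n^{(t-1)/t})|<1$), for $n$ large enough that $1\le s(n)\le n-1$. Then $$\lim_{n\to\infty}\mathbb{E}[Y_{n,s(n)}]=t e^{-\lambda^t}+(t+1)\left(1-e^{-\lambda^t}\right).$$ Moreover, $Y_{n,s(n)}$ converges in distribution, as $n\to\infty$, to a random variable $Z$ with $$\mathbb{P}[Z=t]=e^{-\lambda^t},\qquad \mathbb{P}[Z=t+1]=1-e^{-\lambda^t}.$$ (b) Let $s=s(n)$ be integers with $1\le s(n)\le n-1$ such that $s(n)=n-o\!\left(n^{t/(t+1)}\right)$ and $s(n)=n-\omega\!\left(n^{(t-1)/t}\right)$, that is, $\frac{n-s(n)}{n^{t/(t+1)}}\to 0$ and $\frac{n-s(n)}{n^{(t-1)/t}}\to\infty$ as $n\to\infty$. Then $$\lim_{n\to\infty}\mathbb{E}[Y_{n,s(n)}]=t+1.$$ Moreover, $Y_{n,s(n)}$ converges in probability to the constant $t+1$ as $n\to\infty$.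
   Context: Coupon collector's problem with group drawings: there are $n$ distinct coupons. At each step (draw) $k=1,2,3,\ldots$ one obtains a package, which is a set of $s$ distinct coupons ($1\le s\le n-1$), chosen uniformly at random among all $\binom{n}{s}$ subsets of size $s$, independently of the other draws. $Y_{n,s}$ is the (random) smallest number of draws after which every one of the $n$ coupons has appeared in at least one drawn package. For sequences $a_n$, $b_n$ with $b_n>0$ for large $n$, $a_n=\omega(b_n)$ means $\lim_{n\to\infty} a_n/b_n=\infty$. Convergence in distribution of $X_n$ to $X$ means that the cumulative distribution functions satisfy $F_n(x)\to F(x)$ at every continuity point $x$ of $F$. Convergence in probability of $X_n$ to $X$ means $\lim_{n\to\infty}\mathbb{P}(|X_n-X|>\varepsilon)=0$ for all $\varepsilon>0$. *)

theory Defs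
  imports "HOL-Probability.Probability"
begin

definition packages :: "nat \<Rightarrow> nat \<Rightarrow> nat set set" where
  "packages n s = {A. A \<subseteq> {..<n} \<and> card A = s}"

text \<open>
  The canonical space of infinite sequences of independent, uniformly distributed packages.
  Draws are numbered from \<open>0\<close>, so \<open>\<omega> 0, \<dots>, \<omega> (k - 1)\<close> are the packages of the first \<open>k\<close> draws.
  It is meaningful only for \<open>s \<le> n\<close>: otherwise \<open>packages n s\<close> is empty and
  \<^const>\<open>pmf_of_set\<close> is unspecified.
\<close>

definition draws :: "nat \<Rightarrow> nat \<Rightarrow> (nat \<Rightarrow> nat set) measure" where
  "draws n s = (\<Pi>\<^sub>M k\<in>(UNIV :: nat set). measure_pmf (pmf_of_set (packages n s)))"

text \<open>
  The coupon collector's time \<open>Y\<^sub>n\<^sub>,\<^sub>s\<close> as a random variable on \<open>draws n s\<close>; the parameter \<open>s\<close>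
  enters only through the measure. If some coupon never appears, the value is unspecified
  (the same number for all such \<open>\<omega>\<close>); for \<open>1 \<le> s \<le> n\<close> this happens with probability \<open>0\<close>.
\<close>

definition collect_time :: "nat \<Rightarrow> (nat \<Rightarrow> nat set) \<Rightarrow> nat" where
  "collect_time n \<omega> = (LEAST k. \<forall>i<n. \<exists>j<k. i \<in> \<omega> j)"

text \<open>
  The limit is a constant, so the variables \<open>X n\<close> may live on different probability spaces.
\<close>

definition converges_in_prob_const ::
    "(nat \<Rightarrow> 'a measure) \<Rightarrow> (nat \<Rightarrow> 'a \<Rightarrow> real) \<Rightarrow> real \<Rightarrow> bool" where
  "converges_in_prob_const M X c \<longleftrightarrow>
     (\<forall>\<epsilon>>0. (\<lambda>n. measure (M n) {\<omega> \<in> space (M n). \<bar>X n \<omega> - c\<bar> > \<epsilon>}) \<longlonglongrightarrow> 0)"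

end

theory Submission
  imports Defs
begin

text \<open>
  Let \<open>p = (n - s) / n\<close> be the probability that a fixed coupon is missing from a package. The number of
  coupons missing after \<open>k\<close> draws has mean \<open>n p\<^sup>k\<close>, and the indicators of missing coupons are negatively
  correlated. Hence all coupons are collected after \<open>k\<close> draws with probability tending to \<open>0\<close> if
  \<open>n p\<^sup>k\<close> tends to infinity (second moment), to \<open>1\<close> if \<open>n p\<^sup>k\<close> tends to \<open>0\<close> (first moment), and to
  \<open>exp (- L)\<close> if \<open>n p\<^sup>k\<close> tends to \<open>L\<close> while \<open>n - s\<close> tends to infinity (inclusion-exclusion). As \<open>p\<close> tends to
  \<open>0\<close>, only \<open>k = t\<close> is undecided. The expectation is the sum over \<open>k\<close> of the probabilities that
  \<open>k\<close> draws do not suffice; these decay geometrically, so its limit is taken term by term.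
\<close>

section \<open>Hypergeometric probability that one package avoids \<open>r\<close> given
  coupons\<close>

definition avoid_prob :: "nat \<Rightarrow> nat \<Rightarrow> nat \<Rightarrow> real" where
  "avoid_prob n s r = real (n - r choose s) / real (n choose s)"

definition missing :: "nat \<Rightarrow> nat set \<Rightarrow> (nat \<Rightarrow> nat set) set" where
  "missing k T = {\<omega>. \<forall>j<k. \<omega> j \<inter> T = {}}"

definition collected :: "nat \<Rightarrow> nat \<Rightarrow> (nat \<Rightarrow> nat set) set" where
  "collected n k = {\<omega>. \<forall>i<n. \<exists>j<k. i \<in> \<omega> j}"

lemma avoid_prob_nonneg: "avoid_prob n s r \<ge> 0"
  by (simp add: avoid_prob_def)

text \<open>Absorption for binomial coefficients. The new factor is the conditional probability of
  avoiding one more coupon when \<open>r\<close> of them are already avoided.\<close>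

lemma avoid_prob_Suc:
  assumes "r < n"
  shows "avoid_prob n s (Suc r) = avoid_prob n s r * ((real (n - s) - real r) / (real n - real r))"
proof -
  have "(n - r - s) * (n - r choose s) = (n - r) * (n - r - 1 choose s)"
    by (rule binomial_absorb_comp)
  hence "real (n - r - s) * real (n - r choose s) = real (n - r) * real (n - Suc r choose s)"
    by (simp flip: of_nat_mult)
  \<comment> \<open>For \<open>s > n - r\<close> the natural subtraction truncates to 0 while the
    real difference is negative; both products are still 0 because the binomial coefficient
    vanishes.\<close>
  moreover have "real (n - r - s) * real (n - r choose s) = (real (n - s) - real r) * real (n - r choose s)"
    by (cases "s \<le> n - r") (use assms in \<open>simp_all add: of_nat_diff binomial_eq_0\<close>)
  ultimately have "real (n - Suc r choose s) = real (n - r choose s) * (real (n - s) - real r) / (real n - real r)"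
    using assms by (simp add: field_simps of_nat_diff)
  thus ?thesis by (simp add: avoid_prob_def)
qed

lemma avoid_prob_0: "s \<le> n \<Longrightarrow> avoid_prob n s 0 = 1"
  by (simp add: avoid_prob_def)

lemma avoid_prob_eq_prod:
  assumes "s \<le> n" "r \<le> n"
  shows "avoid_prob n s r = (\<Prod>i<r. (real (n - s) - real i) / (real n - real i))"
  using assms(2)
  by (induction r) (simp_all add: avoid_prob_0 assms(1) avoid_prob_Suc)

text \<open>With \<open>m = n - s\<close>, each factor \<open>(m - r) / (n - r)\<close> is at most
  \<open>m / n\<close>. A factor can be negative once \<open>r > m\<close>, so the induction
  multiplies this inequality by the nonnegative \<open>avoid_prob n s r\<close> instead of comparing
  products factor by factor. The case \<open>r = 2\<close> is the negative correlation of missing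
  coupons.\<close>

lemma avoid_prob_le:
  assumes "s \<le> n" "r \<le> n"
  shows "avoid_prob n s r \<le> (real (n - s) / real n) ^ r"
  using assms(2)
proof (induction r)
  case (Suc r)
  have "(real (n - s) - real r) / (real n - real r) \<le> real (n - s) / real n"
    using Suc.prems assms(1) by (simp add: field_simps of_nat_diff)
  hence "avoid_prob n s (Suc r) \<le> avoid_prob n s r * (real (n - s) / real n)"
    using Suc.prems by (simp only: avoid_prob_Suc mult_left_mono avoid_prob_nonneg)
  also have "\<dots> \<le> (real (n - s) / real n) ^ r * (real (n - s) / real n)"
    using Suc by (intro mult_right_mono) auto
  finally show ?case by (simp only: power_Suc mult.commute)
qed (simp add: avoid_prob_0 assms(1))

lemma finite_packages: "finite (packages n s)"
  by (rule finite_subset[of _ "Pow {..<n}"]) (auto simp: packages_def)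

lemma packages_nonempty: "s \<le> n \<Longrightarrow> packages n s \<noteq> {}"
  by (auto simp: packages_def intro!: exI[of _ "{..<s}"])

lemma measure_package_avoids:
  assumes "s \<le> n" "T \<subseteq> {..<n}"
  shows "measure (measure_pmf (pmf_of_set (packages n s))) {A. A \<inter> T = {}} = avoid_prob n s (card T)"
proof -
  have "packages n s \<inter> {A. A \<inter> T = {}} = {A. A \<subseteq> {..<n} - T \<and> card A = s}"
    by (auto simp: packages_def)
  moreover have "card ({..<n} - T) = n - card T"
    using assms(2) by (simp add: card_Diff_subset finite_subset)
  ultimately show ?thesis
    using assms(1) n_subsets[of "{..<n}" s] n_subsets[of "{..<n} - T" s]
    by (simp add: measure_pmf_of_set finite_packages packages_nonempty avoid_prob_def)
       (simp add: packages_def)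
qed

section \<open>The product space of draws and measurability\<close>

lemma prob_space_draws: "prob_space (draws n s)"
  unfolding draws_def by (intro prob_space_PiM measure_pmf.prob_space_axioms)

lemma space_draws [simp]: "space (draws n s) = UNIV"
  by (simp add: draws_def space_PiM)

text \<open>An arbitrary predicate \<open>P\<close> is allowed because every set is measurable in
  the discrete space of a single draw.\<close>

lemma sets_draws_component [measurable]: "{\<omega>. P (\<omega> j)} \<in> sets (draws n s)"
proof -
  have "(\<lambda>\<omega>. \<omega> j) -` {A. P A} \<inter> space (draws n s) \<in> sets (draws n s)"
    unfolding draws_def by (rule measurable_sets[OF measurable_component_singleton]) auto
  thus ?thesis by (simp add: vimage_def)
qed

lemma pred_draws_component [measurable]: "Measurable.pred (draws n s) (\<lambda>\<omega>. P (\<omega> j))"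
  unfolding pred_def using sets_draws_component[of P j n s] by simp

lemma missing_in_sets [measurable]: "missing k T \<in> sets (draws n s)"
proof -
  have "Measurable.pred (draws n s) (\<lambda>\<omega>. \<forall>j<k. \<omega> j \<inter> T = {})"
    by measurable
  thus ?thesis unfolding missing_def pred_def by simp
qed

lemma collected_in_sets [measurable]: "collected n k \<in> sets (draws n' s)"
proof -
  have "Measurable.pred (draws n' s) (\<lambda>\<omega>. \<forall>i<n. \<exists>j<k. i \<in> \<omega> j)"
    by measurable
  thus ?thesis unfolding collected_def pred_def by simp
qed

lemma measurable_collect_time [measurable]:
  "collect_time n \<in> measurable (draws n' s) (count_space UNIV)"
  unfolding collect_time_def[abs_def] by measurable

section \<open>Probability that \<open>k\<close> draws suffice: exact formula and moment
  bounds\<close>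

lemma prob_missing:
  assumes "s \<le> n" "T \<subseteq> {..<n}"
  shows "measure (draws n s) (missing k T) = avoid_prob n s (card T) ^ k"
proof -
  let ?p = "measure_pmf (pmf_of_set (packages n s))"
  interpret P: product_prob_space "\<lambda>_::nat. ?p" UNIV
    by unfold_locales
  \<comment> \<open>The event is a cylinder over the first \<open>k\<close> coordinates, so
    independence turns its probability into a \<open>k\<close>-th power.\<close>
  have "missing k T = prod_emb UNIV (\<lambda>_. ?p) {..<k} (Pi\<^sub>E {..<k} (\<lambda>_. {A. A \<inter> T = {}}))"
    by (fastforce simp: missing_def prod_emb_def space_PiM Pi_iff)
  thus ?thesis
    using P.measure_PiM_emb[of "{..<k}" "\<lambda>_. {A. A \<inter> T = {}}"]
    by (simp add: draws_def measure_package_avoids[OF assms])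
qed

text \<open>Inclusion-exclusion over the sets \<open>B\<close> of missing coupons. The probability
  of \<open>missing k B\<close> depends only on \<open>card B\<close>, so equal cardinalities are
  grouped, and the 1 from passing to the complement becomes the term \<open>r = 0\<close>.\<close>

lemma prob_collected:
  assumes "s \<le> n"
  shows "measure (draws n s) (collected n k) =
    (\<Sum>r\<le>n. (-1) ^ r * real (n choose r) * avoid_prob n s r ^ k)"
proof -
  interpret prob_space "draws n s" by (rule prob_space_draws)
  interpret Incl_Excl "\<lambda>A. A \<in> events" prob
    by unfold_locales (auto simp: finite_measure_Union disjnt_def)
  let ?f = "\<lambda>r. (-1) ^ r * avoid_prob n s r ^ k"
  have inter: "(\<Inter>i\<in>B. missing k {i}) = missing k B" for B
    by (auto simp: missing_def)
  have compl: "collected n k = space (draws n s) - (\<Union>i\<in>{..<n}. missing k {i})"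
    by (auto simp: collected_def missing_def)
  have "prob (collected n k) = 1 - prob (\<Union>i\<in>{..<n}. missing k {i})"
    unfolding compl by (rule prob_compl) auto
  also have "prob (\<Union>i\<in>{..<n}. missing k {i}) =
      (\<Sum>B | B \<subseteq> {..<n} \<and> B \<noteq> {}. (-1) ^ (card B + 1) * prob (missing k B))"
    using restricted_indexed[of "{..<n}" "\<lambda>i. missing k {i}"] by (simp add: inter)
  also have "\<dots> = (\<Sum>B\<in>Pow {..<n} - {{}}. - ?f (card B))"
    by (rule sum.cong) (auto simp: prob_missing assms)
  also have "\<dots> = - (\<Sum>B\<in>Pow {..<n}. ?f (card B)) + 1"
    by (simp add: sum_negf sum_diff1 avoid_prob_0 assms)
  also have "(\<Sum>B\<in>Pow {..<n}. ?f (card B)) =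
      (\<Sum>r\<le>n. \<Sum>B | B \<in> Pow {..<n} \<and> card B = r. ?f (card B))"
    by (rule sum.group[symmetric]) (use card_mono[of "{..<n}"] in auto)
  also have "\<dots> = (\<Sum>r\<le>n. real (n choose r) * ?f r)"
    by (rule sum.cong) (simp_all add: n_subsets)
  finally show ?thesis by (simp add: mult_ac)
qed

text \<open>Union bound over the coupons. For fixed \<open>n\<close> it is geometric in
  \<open>k\<close>, which later also controls the tails of the collection time.\<close>

lemma prob_not_collected_le:
  assumes "1 \<le> s" "s \<le> n"
  shows "1 - measure (draws n s) (collected n k) \<le> real n * (real (n - s) / real n) ^ k"
proof -
  interpret prob_space "draws n s" by (rule prob_space_draws)
  have compl: "space (draws n s) - collected n k = (\<Union>i\<in>{..<n}. missing k {i})"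
    by (auto simp: collected_def missing_def)
  have "1 - prob (collected n k) = prob (\<Union>i\<in>{..<n}. missing k {i})"
    unfolding compl[symmetric] by (rule prob_compl[symmetric]) auto
  also have "\<dots> \<le> (\<Sum>i<n. prob (missing k {i}))"
    by (rule finite_measure_subadditive_finite) auto
  also have "\<dots> = real n * avoid_prob n s 1 ^ k"
    using assms by (simp add: prob_missing)
  also have "\<dots> \<le> real n * (real (n - s) / real n) ^ k"
    using assms avoid_prob_le[of s n 1]
    by (intro mult_left_mono power_mono) (auto simp: avoid_prob_nonneg)
  finally show ?thesis .
qed

text \<open>Chebyshev's inequality for the number of missing coupons, whose variance is at most its mean.\<close>
lemma prob_collected_le:
  assumes "1 \<le> s" "s < n"
  shows "measure (draws n s) (collected n k) * (real n * (real (n - s) / real n) ^ k) \<le> 1"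
proof -
  interpret prob_space "draws n s" by (rule prob_space_draws)
  define \<mu> where "\<mu> = real n * (real (n - s) / real n) ^ k"
  define I where "I i = (indicator (missing k {i}) :: _ \<Rightarrow> real)" for i
  define W where "W \<omega> = (\<Sum>i<n. I i \<omega>)" for \<omega>
  have pos: "\<mu> > 0" using assms by (auto simp: \<mu>_def)
  have one: "avoid_prob n s 1 = real (n - s) / real n"
    using assms by (simp add: avoid_prob_Suc avoid_prob_0)
  have [measurable]: "I i \<in> borel_measurable (draws n s)" for i
    unfolding I_def by measurable
  have prodI: "I i \<omega> * I j \<omega> = indicator (missing k {i, j}) \<omega>" for i j \<omega>
    by (auto simp: I_def missing_def indicator_def)
  have intI: "integrable (draws n s) (I i)" "integrable (draws n s) (\<lambda>\<omega>. I i \<omega> * I j \<omega>)" for i j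
    unfolding prodI by (auto simp: I_def emeasure_eq_measure)
  have EI: "expectation (I i) = (real (n - s) / real n) ^ k" if "i < n" for i
    using that assms by (simp add: I_def prob_missing one[simplified])
  have EW: "expectation W = \<mu>"
    using intI EI unfolding W_def by (simp add: \<mu>_def)
  \<comment> \<open>Negative correlation bounds an off-diagonal pair by the product of the means.
    The diagonal has an extra term; summed over all coupons, these extra terms give the single \<mu>
    in the second moment.\<close>
  have pair: "expectation (\<lambda>\<omega>. I i \<omega> * I j \<omega>) \<le> (if i = j then (real (n - s) / real n) ^ k else 0)
      + ((real (n - s) / real n) ^ k) ^ 2" if "i < n" "j < n" for i j
  proof (cases "i = j")
    case True
    thus ?thesis using EI[OF that(1)] unfolding prodI by (simp add: I_def)
  next
    case False
    have "expectation (\<lambda>\<omega>. I i \<omega> * I j \<omega>) = avoid_prob n s 2 ^ k"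
      using False that assms unfolding prodI by (simp add: prob_missing numeral_2_eq_2)
    also have "\<dots> \<le> ((real (n - s) / real n) ^ 2) ^ k"
      using assms False that by (intro power_mono avoid_prob_le avoid_prob_nonneg) auto
    also have "\<dots> = ((real (n - s) / real n) ^ k) ^ 2"
      by (simp only: power_mult[symmetric] mult.commute)
    finally show ?thesis using False by simp
  qed
  have W2: "W \<omega> ^ 2 = (\<Sum>i<n. \<Sum>j<n. I i \<omega> * I j \<omega>)" for \<omega>
    by (simp add: W_def power2_eq_square sum_product)
  have "expectation (\<lambda>\<omega>. W \<omega> ^ 2) = (\<Sum>i<n. \<Sum>j<n. expectation (\<lambda>\<omega>. I i \<omega> * I j \<omega>))"
    unfolding W2 using intI by simp
  also have "\<dots> \<le> (\<Sum>i<n. \<Sum>j<n. (if i = j then (real (n - s) / real n) ^ k else 0)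
      + ((real (n - s) / real n) ^ k) ^ 2)"
    using pair by (intro sum_mono) auto
  also have "\<dots> = \<mu> + \<mu> ^ 2"
    by (simp add: sum.distrib \<mu>_def power2_eq_square algebra_simps)
  finally have EW2: "expectation (\<lambda>\<omega>. W \<omega> ^ 2) \<le> \<mu> + \<mu> ^ 2" .
  have iW: "integrable (draws n s) W" "integrable (draws n s) (\<lambda>\<omega>. W \<omega> ^ 2)"
    unfolding W2 unfolding W_def using intI by auto
  have "prob (collected n k) * \<mu> ^ 2 = expectation (\<lambda>\<omega>. indicator (collected n k) \<omega> * \<mu> ^ 2)"
    by simp
  also have "\<dots> \<le> expectation (\<lambda>\<omega>. W \<omega> ^ 2 - 2 * \<mu> * W \<omega> + \<mu> ^ 2)"
  proof (rule integral_mono)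
    \<comment> \<open>The right-hand side is the square of \<open>W \<omega> - \<mu>\<close>. When
      everything is collected, \<open>W\<close> is 0 and the square equals the square of \<mu>;
      otherwise it only has to be nonnegative.\<close>
    show "indicator (collected n k) \<omega> * \<mu> ^ 2 \<le> W \<omega> ^ 2 - 2 * \<mu> * W \<omega> + \<mu> ^ 2" for \<omega>
    proof (cases "\<omega> \<in> collected n k")
      case True
      hence "W \<omega> = 0"
        by (auto simp: W_def I_def collected_def missing_def indicator_def intro!: sum.neutral)
      thus ?thesis using True by simp
    next
      case False
      have "W \<omega> ^ 2 - 2 * \<mu> * W \<omega> + \<mu> ^ 2 = (W \<omega> - \<mu>) ^ 2"
        by (simp add: power2_eq_square algebra_simps)
      thus ?thesis using False by simp
    qed
  qed (use iW in \<open>auto simp: emeasure_eq_measure\<close>)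
  also have "\<dots> = expectation (\<lambda>\<omega>. W \<omega> ^ 2) - 2 * \<mu> * \<mu> + \<mu> ^ 2"
    using iW EW by (simp add: prob_space[simplified])
  also have "\<dots> \<le> \<mu>" using EW2 by (simp add: power2_eq_square)
  finally show ?thesis using pos by (simp add: \<mu>_def[symmetric] power2_eq_square)
qed

section \<open>Distribution and expectation of the collection time\<close>

lemma collected_mono: "j \<le> k \<Longrightarrow> collected n j \<subseteq> collected n k"
  unfolding collected_def by (blast intro: less_le_trans)

text \<open>The junk value of \<^const>\<open>collect_time\<close> is harmless because it is attained on a null set.\<close>
lemma prob_collect_time_le:
  assumes "1 \<le> s" "s \<le> n"
  shows "measure (draws n s) {\<omega>. collect_time n \<omega> \<le> k} = measure (draws n s) (collected n k)"
proof -
  interpret prob_space "draws n s" by (rule prob_space_draws)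
  have meas: "{\<omega>. collect_time n \<omega> \<le> k} \<in> events"
    using measurable_sets[OF measurable_collect_time, of "{..k}" n n s] by (simp add: vimage_def)
  \<comment> \<open>If the time is at most \<open>k\<close> although \<open>k\<close> draws do not
    suffice, then the value is junk and no number \<open>j\<close> of draws suffices. The bound for
    this event tends to 0 as \<open>j\<close> goes to infinity.\<close>
  have "prob {\<omega>. collect_time n \<omega> \<le> k}
      \<le> prob (collected n k) + real n * (real (n - s) / real n) ^ j" for j
  proof -
    have "{\<omega>. collect_time n \<omega> \<le> k} \<subseteq> collected n k \<union> (space (draws n s) - collected n j)"
    proof safe
      fix \<omega> assume k: "collect_time n \<omega> \<le> k" and nk: "\<omega> \<notin> collected n k" and j: "\<omega> \<in> collected n j"
      from j have "\<forall>i<n. \<exists>l<j. i \<in> \<omega> l" by (simp add: collected_def)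
      hence "\<forall>i<n. \<exists>l<collect_time n \<omega>. i \<in> \<omega> l"
        unfolding collect_time_def by (rule LeastI)
      hence "\<omega> \<in> collected n (collect_time n \<omega>)" by (simp add: collected_def)
      with nk collected_mono[OF k, of n] show False by blast
    qed simp
    hence "prob {\<omega>. collect_time n \<omega> \<le> k} \<le> prob (collected n k \<union> (space (draws n s) - collected n j))"
      by (intro finite_measure_mono sets.Un sets.Diff collected_in_sets sets.top)
    also have "\<dots> \<le> prob (collected n k) + prob (space (draws n s) - collected n j)"
      by (intro measure_Un_le sets.Diff collected_in_sets sets.top)
    also have "prob (space (draws n s) - collected n j) = 1 - prob (collected n j)"
      by (rule prob_compl) auto
    finally show ?thesis using prob_not_collected_le[OF assms, of j] by linarith
  qed
  moreover have "(\<lambda>j. prob (collected n k) + real n * (real (n - s) / real n) ^ j)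
      \<longlonglongrightarrow> prob (collected n k) + real n * 0"
    using assms by (intro tendsto_intros LIMSEQ_power_zero) auto
  ultimately have "prob {\<omega>. collect_time n \<omega> \<le> k} \<le> prob (collected n k)"
    by (intro LIMSEQ_le_const[of "\<lambda>j. prob (collected n k) + real n * (real (n - s) / real n) ^ j"]) auto
  moreover have "collected n k \<subseteq> {\<omega>. collect_time n \<omega> \<le> k}"
    by (auto simp: collected_def collect_time_def intro!: Least_le)
  hence "prob (collected n k) \<le> prob {\<omega>. collect_time n \<omega> \<le> k}"
    by (intro finite_measure_mono meas)
  ultimately show ?thesis by simp
qed

text \<open>The tail-sum formula for a variable with values in the natural numbers, first in the
  extended nonnegative reals. The ratio \<open>(n - s) / n\<close> is below 1, so the series
  converges and the formula passes to the real integral.\<close>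

lemma expectation_collect_time:
  assumes "1 \<le> s" "s < n"
  shows "(\<integral>\<omega>. real (collect_time n \<omega>) \<partial>draws n s) = (\<Sum>k. 1 - measure (draws n s) (collected n k))"
proof -
  interpret prob_space "draws n s" by (rule prob_space_draws)
  have tail: "prob {\<omega>. k < collect_time n \<omega>} = 1 - prob (collected n k)" for k
  proof -
    have "prob (space (draws n s) - {\<omega>. collect_time n \<omega> \<le> k}) = 1 - prob {\<omega>. collect_time n \<omega> \<le> k}"
      using measurable_sets[OF measurable_collect_time, of "{..k}" n n s]
      by (intro prob_compl) (simp add: vimage_def)
    moreover have "space (draws n s) - {\<omega>. collect_time n \<omega> \<le> k} = {\<omega>. k < collect_time n \<omega>}" by auto
    ultimately show ?thesis using assms by (simp add: prob_collect_time_le)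
  qed
  have summ: "summable (\<lambda>k. 1 - prob (collected n k))"
  proof (rule summable_comparison_test_ev)
    show "eventually (\<lambda>k. norm (1 - prob (collected n k)) \<le> real n * (real (n - s) / real n) ^ k) sequentially"
      using prob_not_collected_le[of s n] assms by (intro always_eventually) auto
    show "summable (\<lambda>k. real n * (real (n - s) / real n) ^ k)"
      using assms by (intro summable_mult summable_geometric) auto
  qed
  have "(\<integral>\<^sup>+\<omega>. ennreal (real (collect_time n \<omega>)) \<partial>draws n s) = (\<Sum>k. ennreal (1 - prob (collected n k)))"
    using nn_integral_nat_function[OF measurable_collect_time[of n n s]]
    by (simp add: ennreal_of_nat_eq_real_of_nat emeasure_eq_measure tail)
  also have "\<dots> = ennreal (\<Sum>k. 1 - prob (collected n k))"
    using summ by (intro suminf_ennreal2) auto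
  finally show ?thesis
    using suminf_nonneg[OF summ] by (subst integral_eq_nn_integral) auto
qed

section \<open>Poisson limit of the completion probability\<close>

text \<open>
  The \<open>r\<close>-th term of the inclusion-exclusion sum is dominated by \<open>(n ((n - s) / n)\<^sup>k)\<^sup>r / r!\<close>, so the
  limit may be taken term by term.
\<close>
lemma prob_collected_poisson_limit:
  assumes s: "\<forall>\<^sub>F n in sequentially. s n \<le> n"
    and m: "filterlim (\<lambda>n. real (n - s n)) at_top sequentially"
    and L: "(\<lambda>n. real n * (real (n - s n) / real n) ^ k) \<longlonglongrightarrow> L"
  shows "(\<lambda>n. measure (draws n (s n)) (collected n k)) \<longlonglongrightarrow> exp (- L)"
proof -
  define a where "a r n = (-1) ^ r * real (n choose r) * avoid_prob n (s n) r ^ k" for r n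
  have lim: "(\<lambda>n. a r n) \<longlonglongrightarrow> (- L) ^ r / fact r" for r
  proof -
    \<comment> \<open>The factor of index \<open>i\<close> in the product form of
      \<open>a r n\<close>, with the mean \<open>n * ((n - s n) / n) ^ k\<close> split off. What
      remains tends to 1 because both \<open>n\<close> and \<open>n - s n\<close> tend to
      infinity.\<close>
    define b where "b i n = real n * (real (n - s n) / real n) ^ k *
      ((1 - real i / real n) * ((1 - real i / real (n - s n)) / (1 - real i / real n)) ^ k)" for i n
    have inv: "(\<lambda>n. real i / real n) \<longlonglongrightarrow> 0" "(\<lambda>n. real i / real (n - s n)) \<longlonglongrightarrow> 0" for i
      using m by (auto intro!: real_tendsto_divide_at_top[OF tendsto_const] filterlim_real_sequentially)
    have "b i \<longlonglongrightarrow> L * ((1 - 0) * ((1 - 0) / (1 - 0)) ^ k)" for i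
      unfolding b_def by (intro tendsto_intros L inv) auto
    hence "(\<lambda>n. (-1) ^ r / fact r * (\<Prod>i<r. b i n)) \<longlonglongrightarrow> (-1) ^ r / fact r * (\<Prod>i<r. L)"
      by (intro tendsto_intros) auto
    moreover have "\<forall>\<^sub>F n in sequentially. (-1) ^ r / fact r * (\<Prod>i<r. b i n) = a r n"
      using s eventually_gt_at_top[of r] filterlim_at_top_dense[THEN iffD1, OF m, rule_format, of "0"]
    proof eventually_elim
      case (elim n)
      have "real (n choose r) = (\<Prod>i<r. real n - real i) / fact r"
        by (simp add: binomial_gbinomial gbinomial_prod_rev atLeast0LessThan)
      hence "a r n = (-1) ^ r / fact r *
          (\<Prod>i<r. (real n - real i) * ((real (n - s n) - real i) / (real n - real i)) ^ k)"
        using elim by (simp add: a_def avoid_prob_eq_prod prod_power_distrib prod.distrib)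
      also have "(\<Prod>i<r. (real n - real i) * ((real (n - s n) - real i) / (real n - real i)) ^ k) = (\<Prod>i<r. b i n)"
      proof (rule prod.cong)
        fix i assume "i \<in> {..<r}"
        define m where "m = real (n - s n)"
        have "m > 0" "real n > 0" "real n - real i > 0"
          using elim \<open>i \<in> {..<r}\<close> by (auto simp: m_def)
        hence eq: "real n - real i = real n * (1 - real i / real n)"
            "m - real i = m * (1 - real i / m)"
          by (simp_all add: right_diff_distrib)
        show "(real n - real i) * ((real (n - s n) - real i) / (real n - real i)) ^ k = b i n"
          unfolding b_def m_def[symmetric] eq times_divide_times_eq[symmetric] power_mult_distrib
          by (simp only: mult_ac)
      qed simp
      finally show ?case by simp
    qed
    ultimately have "a r \<longlonglongrightarrow> (-1) ^ r / fact r * (\<Prod>i<r. L)"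
      by (rule Lim_transform_eventually)
    thus ?thesis by (simp add: power_minus[of L])
  qed
  \<comment> \<open>Eventually the mean is below \<open>L + 1\<close>, which gives one majorant for
    all large \<open>n\<close>, summable in \<open>r\<close>.\<close>
  have ev: "\<forall>\<^sub>F n in sequentially. \<forall>r. norm (a r n) \<le> (L + 1) ^ r / fact r"
    using s order_tendstoD(2)[OF L, of "L + 1", simplified]
  proof eventually_elim
    case (elim n)
    show ?case
    proof
      fix r
      show "norm (a r n) \<le> (L + 1) ^ r / fact r"
      proof (cases "r \<le> n")
        case True
        have "norm (a r n) = real (n choose r) * avoid_prob n (s n) r ^ k"
          by (simp add: a_def abs_mult avoid_prob_nonneg power_abs)
        also have "\<dots> \<le> real n ^ r / fact r * ((real (n - s n) / real n) ^ r) ^ k"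
        proof (intro mult_mono power_mono avoid_prob_le avoid_prob_nonneg)
          have "real (fact r * (n choose r)) \<le> real (n ^ r)"
            by (rule of_nat_mono) (rule binomial_fact_pow[of n r, unfolded mult.commute[of "n choose r"]])
          thus "real (n choose r) \<le> real n ^ r / fact r" by (simp add: field_simps)
        qed (use True elim in \<open>auto simp: avoid_prob_nonneg\<close>)
        also have "\<dots> = (real n * (real (n - s n) / real n) ^ k) ^ r / fact r"
          by (simp only: power_mult_distrib power_mult[symmetric] mult.commute[of k] times_divide_eq_left)
        also have "\<dots> \<le> (L + 1) ^ r / fact r"
          using elim by (intro divide_right_mono power_mono) auto
        finally show ?thesis .
      next
        case False
        \<comment> \<open>For \<open>r > n\<close> the term is 0 and only the sign of the majorant
          matters: \<open>L + 1\<close> exceeds a nonnegative mean.\<close>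
        have "0 \<le> real n * (real (n - s n) / real n) ^ k" by simp
        with elim have "L + 1 \<ge> 0" by linarith
        thus ?thesis using False by (simp add: a_def binomial_eq_0)
      qed
    qed
  qed
  have "(\<lambda>n. \<Sum>r. a r n) \<longlonglongrightarrow> (\<Sum>r. (- L) ^ r / fact r)"
  proof (rule tannerys_theorem[THEN conjunct2, THEN conjunct2])
    show "\<forall>\<^sub>F (r, n) in at_top \<times>\<^sub>F sequentially. norm (a r n) \<le> (L + 1) ^ r / fact r"
      by (rule eventually_mono[OF eventually_prod2[THEN iffD2, OF _ ev]]) auto
    show "summable (\<lambda>r. (L + 1) ^ r / fact r)"
      using summable_exp[of "L + 1"] by (simp add: field_simps)
  qed (use lim in auto)
  moreover have "\<forall>\<^sub>F n in sequentially. (\<Sum>r. a r n) = measure (draws n (s n)) (collected n k)"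
    using s
  proof eventually_elim
    case (elim n)
    \<comment> \<open>The binomial coefficients vanish for \<open>r > n\<close>, so the series is
      the finite inclusion-exclusion sum.\<close>
    have "(\<Sum>r. a r n) = (\<Sum>r\<le>n. a r n)"
      by (rule suminf_finite) (auto simp: a_def binomial_eq_0)
    thus ?case using elim by (simp add: prob_collected a_def)
  qed
  ultimately show ?thesis
    by (auto simp: exp_def divide_inverse mult.commute scaleR_conv_of_real elim: Lim_transform_eventually)
qed

section \<open>Limit law and limit mean shared by both regimes\<close>

locale threshold =
  fixes s :: "nat \<Rightarrow> nat" and t :: nat and q :: real
  assumes s_bounds: "\<forall>\<^sub>F n in sequentially. 1 \<le> s n \<and> s n < n"
    and below: "filterlim (\<lambda>n. real n * (real (n - s n) / real n) ^ (t - 1)) at_top sequentially"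
    and above: "(\<lambda>n. real n * (real (n - s n) / real n) ^ (t + 1)) \<longlonglongrightarrow> 0"
    and at_t: "(\<lambda>n. measure (draws n (s n)) (collected n t)) \<longlonglongrightarrow> q"
begin

text \<open>Distribution function, at integers, of the law with mass \<open>q\<close> at
  \<open>t\<close> and \<open>1 - q\<close> at \<open>t + 1\<close>. The two regimes differ only in
  \<open>q\<close>, which is \<open>exp (- (lam ^ t))\<close> in the first and 0 in the
  second.\<close>

definition limit_cdf :: "nat \<Rightarrow> real" where
  "limit_cdf k = (if k < t then 0 else if k = t then q else 1)"

lemma prob_collected_limit:
  "(\<lambda>n. measure (draws n (s n)) (collected n k)) \<longlonglongrightarrow> limit_cdf k"
proof -
  consider "k < t" | "k = t" | "t < k" by linarith
  thus ?thesis
  proof cases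
    case 1
    have "(\<lambda>n. measure (draws n (s n)) (collected n k)) \<longlonglongrightarrow> 0"
    proof (rule tendsto_sandwich[OF _ _ tendsto_const])
      show "(\<lambda>n. inverse (real n * (real (n - s n) / real n) ^ (t - 1))) \<longlonglongrightarrow> 0"
        using below by (rule tendsto_inverse_0_at_top)
      show "\<forall>\<^sub>F n in sequentially. measure (draws n (s n)) (collected n k) \<le>
          inverse (real n * (real (n - s n) / real n) ^ (t - 1))"
        using s_bounds
      proof eventually_elim
        case (elim n)
        let ?Q = "measure (draws n (s n)) (collected n k)" and ?p = "real (n - s n) / real n"
        have p: "0 < ?p" "?p \<le> 1" "0 < real n" using elim by auto
        \<comment> \<open>As the ratio is at most 1 and \<open>k \<le> t - 1\<close>, the mean after
          \<open>k\<close> draws is at least the diverging mean after \<open>t - 1\<close>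
          draws.\<close>
        have "?Q * (real n * ?p ^ (t - 1)) \<le> ?Q * (real n * ?p ^ k)"
          using p 1 by (intro mult_left_mono power_decreasing) auto
        also have "\<dots> \<le> 1" using elim by (intro prob_collected_le) auto
        finally have *: "?Q * (real n * ?p ^ (t - 1)) \<le> 1" .
        have "real n * ?p ^ (t - 1) > 0" using p by (intro mult_pos_pos zero_less_power)
        thus ?case using * by (simp only: inverse_eq_divide pos_le_divide_eq)
      qed
    qed auto
    thus ?thesis using 1 by (simp add: limit_cdf_def)
  next
    case 2
    thus ?thesis using at_t by (simp add: limit_cdf_def)
  next
    case 3
    have "(\<lambda>n. measure (draws n (s n)) (collected n k)) \<longlonglongrightarrow> 1"
    proof (rule tendsto_sandwich[OF _ _ _ tendsto_const])
      show "(\<lambda>n. 1 - real n * (real (n - s n) / real n) ^ (t + 1)) \<longlonglongrightarrow> 1"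
        using tendsto_diff[OF tendsto_const above, of 1] by simp
      show "\<forall>\<^sub>F n in sequentially. 1 - real n * (real (n - s n) / real n) ^ (t + 1) \<le>
          measure (draws n (s n)) (collected n k)"
        using s_bounds
      proof eventually_elim
        case (elim n)
        have "real n * (real (n - s n) / real n) ^ k \<le> real n * (real (n - s n) / real n) ^ (t + 1)"
          using elim 3 by (intro mult_left_mono power_decreasing) auto
        thus ?case using prob_not_collected_le[of "s n" n k] elim by linarith
      qed
    qed (use prob_space.prob_le_1[OF prob_space_draws] in auto)
    thus ?thesis using 3 by (simp add: limit_cdf_def)
  qed
qed

lemma prob_collect_time_limit:
  "(\<lambda>n. measure (draws n (s n)) {\<omega>. collect_time n \<omega> \<le> k}) \<longlonglongrightarrow> limit_cdf k"
  by (rule Lim_transform_eventually[OF prob_collected_limit])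
     (use s_bounds in \<open>auto elim!: eventually_mono simp: prob_collect_time_le\<close>)

text \<open>The power \<open>t + 1\<close> of the ratio is at most \<open>n\<close> times itself,
  which tends to 0 by \<open>above\<close>; then take roots.\<close>

lemma missing_ratio_tendsto_0: "(\<lambda>n. real (n - s n) / real n) \<longlonglongrightarrow> 0"
proof -
  have "(\<lambda>n. (real (n - s n) / real n) ^ (t + 1)) \<longlonglongrightarrow> 0"
  proof (rule tendsto_sandwich[OF _ _ tendsto_const above])
    show "\<forall>\<^sub>F n in sequentially. (real (n - s n) / real n) ^ (t + 1)
        \<le> real n * (real (n - s n) / real n) ^ (t + 1)"
      using eventually_ge_at_top[of 1]
    proof eventually_elim
      case (elim n)
      show ?case
        using mult_right_mono[of 1 "real n" "(real (n - s n) / real n) ^ (t + 1)"] elim by simp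
    qed
  qed auto
  from tendsto_real_root[OF this, of "t + 1"] show ?thesis
    by (simp add: real_root_power_cancel del: power_Suc)
qed

text \<open>Term-by-term limit in the tail sum. For \<open>k \<le> t + 1\<close> the majorant is at
  least 1, which bounds any probability. For larger \<open>k\<close>, eventually
  \<open>n * p ^ (t + 1) < 1\<close> and \<open>p < 1 / 2\<close>, so each further draw gains a
  factor \<open>1 / 2\<close>.\<close>

lemma expectation_limit:
  "(\<lambda>n. \<integral>\<omega>. real (collect_time n \<omega>) \<partial>draws n (s n)) \<longlonglongrightarrow> real t + (1 - q)"
proof -
  let ?a = "\<lambda>k n. 1 - measure (draws n (s n)) (collected n k)"
  have ev: "\<forall>\<^sub>F n in sequentially. \<forall>k. norm (?a k n) \<le> 2 ^ (t + 1) * (1 / 2) ^ k"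
    using s_bounds order_tendstoD(2)[OF above, of 1, simplified]
      order_tendstoD(2)[OF missing_ratio_tendsto_0, of "1 / 2", simplified]
  proof eventually_elim
    case (elim n)
    interpret prob_space "draws n (s n)" by (rule prob_space_draws)
    show ?case
    proof
      fix k
      show "norm (?a k n) \<le> 2 ^ (t + 1) * (1 / 2) ^ k"
      proof (cases "k \<le> t + 1")
        case True
        have "norm (?a k n) \<le> 1" by simp
        also have "1 = (2::real) ^ k * (1 / 2) ^ k" by (simp flip: power_mult_distrib)
        also have "\<dots> \<le> 2 ^ (t + 1) * (1 / 2) ^ k"
          using True by (intro mult_right_mono power_increasing) auto
        finally show ?thesis .
      next
        case False
        then obtain d where d: "k = t + 1 + d" by (metis le_add_diff_inverse nat_le_linear)
        let ?p = "real (n - s n) / real n"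
        have "norm (?a k n) \<le> real n * ?p ^ k"
          using prob_not_collected_le[of "s n" n k] elim by auto
        also have "\<dots> = (real n * ?p ^ (t + 1)) * ?p ^ d"
          unfolding d power_add by (simp only: mult_ac)
        also have "\<dots> \<le> 1 * (1 / 2) ^ d"
          using elim by (intro mult_mono power_mono) auto
        also have "\<dots> = 2 ^ (t + 1) * (1 / 2) ^ k"
          unfolding d power_add by (simp add: power_divide)
        finally show ?thesis .
      qed
    qed
  qed
  have "(\<lambda>n. \<Sum>k. ?a k n) \<longlonglongrightarrow> (\<Sum>k. 1 - limit_cdf k)"
  proof (rule tannerys_theorem[THEN conjunct2, THEN conjunct2])
    show "\<forall>\<^sub>F (k, n) in at_top \<times>\<^sub>F sequentially. norm (?a k n) \<le> 2 ^ (t + 1) * (1 / 2) ^ k"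
      by (rule eventually_mono[OF eventually_prod2[THEN iffD2, OF _ ev]]) auto
    show "summable (\<lambda>k. 2 ^ (t + 1) * (1 / 2 :: real) ^ k)"
      by (intro summable_mult summable_geometric) auto
  qed (auto intro!: tendsto_intros prob_collected_limit)
  \<comment> \<open>Each \<open>k < t\<close> contributes 1, \<open>k = t\<close> contributes
    \<open>1 - q\<close>, and later \<open>k\<close> contribute nothing.\<close>
  moreover have "(\<Sum>k. 1 - limit_cdf k) = (\<Sum>k\<le>t. 1 - limit_cdf k)"
    by (rule suminf_finite) (auto simp: limit_cdf_def)
  moreover have "\<dots> = real t + (1 - q)"
    by (simp add: limit_cdf_def flip: lessThan_Suc_atMost)
  moreover have "\<forall>\<^sub>F n in sequentially. (\<Sum>k. ?a k n) = (\<integral>\<omega>. real (collect_time n \<omega>) \<partial>draws n (s n))"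
    using s_bounds by eventually_elim (simp add: expectation_collect_time)
  ultimately show ?thesis
    by (simp only: tendsto_cong)
qed

text \<open>The time is integer valued, so for nonnegative \<open>x\<close> only the floor of
  \<open>x\<close> matters. Negative \<open>x\<close> is treated apart because \<open>nat\<close>
  would send its floor to 0.\<close>

lemma real_cdf_limit:
  "(\<lambda>n. cdf (distr (draws n (s n)) borel (\<lambda>\<omega>. real (collect_time n \<omega>))) x) \<longlonglongrightarrow>
     (if x < real t then 0 else if x < real t + 1 then q else 1)"
proof -
  have cdf: "cdf (distr (draws n (s n)) borel (\<lambda>\<omega>. real (collect_time n \<omega>))) x =
      measure (draws n (s n)) {\<omega>. real (collect_time n \<omega>) \<le> x}" for n
    using measurable_compose[OF measurable_collect_time[of n n "s n"] borel_measurable_count_space]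
    by (simp add: cdf_def measure_distr vimage_def)
  show ?thesis
  proof (cases "x < 0")
    case True
    hence "{\<omega>. real (collect_time n \<omega>) \<le> x} = {}" for n by (auto simp: not_le intro: less_le_trans)
    thus ?thesis using True by (simp add: cdf)
  next
    case False
    hence eq: "real m \<le> x \<longleftrightarrow> m \<le> nat \<lfloor>x\<rfloor>" for m by linarith
    have "limit_cdf (nat \<lfloor>x\<rfloor>) = (if x < real t then 0 else if x < real t + 1 then q else 1)"
      using False unfolding limit_cdf_def by (auto; linarith)
    thus ?thesis using prob_collect_time_limit[of "nat \<lfloor>x\<rfloor>"] by (simp add: cdf eq)
  qed
qed

end

section \<open>Two-point weak limits and the scaling identity\<close>

lemma weak_limit_two_point:
  fixes q :: real
  assumes q: "0 \<le> q" "q \<le> 1"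
    and lim: "\<And>x. (\<lambda>n. cdf (M n) x) \<longlonglongrightarrow> (if x < c then 0 else if x < c + 1 then q else 1)"
  shows "\<exists>D. real_distribution D \<and> measure D {c} = q \<and> measure D {c + 1} = 1 - q \<and> weak_conv_m M D"
proof -
  \<comment> \<open>Image of a Bernoulli law, success going to \<open>c\<close> and failure to
    \<open>c + 1\<close>. Its distribution function is the given limit at every \<open>x\<close>, so
    continuity points need not be singled out.\<close>
  define D where "D = distr (measure_pmf (bernoulli_pmf q)) borel (\<lambda>b. if b then c else c + 1)"
  have D: "measure D A = (if c \<in> A then q else 0) + (if c + 1 \<in> A then 1 - q else 0)"
    if "A \<in> sets borel" for A
  proof -
    let ?B = "(\<lambda>b. if b then c else c + 1) -` A"
    have "measure D A = measure (measure_pmf (bernoulli_pmf q)) ?B"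
      using that by (simp add: D_def measure_distr)
    also have "\<dots> = (\<Sum>b\<in>?B. pmf (bernoulli_pmf q) b)"
      by (rule measure_measure_pmf_finite) (rule finite)
    also have "?B = {b. b = True \<and> c \<in> A \<or> b = False \<and> c + 1 \<in> A}" by (auto split: if_splits)
    also have "(\<Sum>b\<in>\<dots>. pmf (bernoulli_pmf q) b) = (\<Sum>b\<in>UNIV. if b = True \<and> c \<in> A \<or> b = False \<and> c + 1 \<in> A
        then pmf (bernoulli_pmf q) b else 0)"
      by (simp add: sum.If_cases)
    finally show ?thesis using q by (simp add: UNIV_bool)
  qed
  have "real_distribution D"
    unfolding D_def real_distribution_def real_distribution_axioms_def
    by (auto intro: prob_space.prob_space_distr measure_pmf.prob_space_axioms)
  moreover have "weak_conv_m M D"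
    unfolding weak_conv_m_def weak_conv_def
  proof (intro allI impI)
    fix x
    have "cdf D x = (if x < c then 0 else if x < c + 1 then q else 1)"
      by (simp add: cdf_def D)
    thus "(\<lambda>n. cdf (M n) x) \<longlonglongrightarrow> cdf D x" using lim[of x] by simp
  qed
  ultimately show ?thesis by (intro exI[of _ D]) (simp add: D)
qed

text \<open>Translates the scale on which \<open>n - s\<close> is measured into the mean number of
  missing coupons after \<open>k\<close> draws. It is applied with \<open>k = t\<close> and
  \<open>k = t + 1\<close>.\<close>

lemma scaled_power:
  assumes "0 < n" "0 < k"
  shows "(m / real n powr ((real k - 1) / real k)) ^ k = real n * (m / real n) ^ k"
proof -
  have "(real n powr ((real k - 1) / real k)) ^ k = real n powr (real k - 1)"
    using assms by (simp add: powr_realpow[symmetric] powr_powr)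
  also have "\<dots> = real n ^ k / real n"
    using assms by (simp add: powr_diff powr_realpow)
  finally show ?thesis using assms by (simp add: power_divide)
qed

section \<open>Verification of the threshold conditions in the two regimes\<close>

theorem theorem2p3:
  fixes t :: nat
  assumes "t \<ge> 2"
  shows
    "(\<forall>(lam :: real) (s :: nat \<Rightarrow> nat).
        lam > 0 \<longrightarrow>
        (\<forall>\<^sub>F n in sequentially. 1 \<le> s n \<and> s n < n \<and>
           \<bar>real (s n) - (real n - lam * real n powr ((real t - 1) / real t))\<bar> < 1) \<longrightarrow>
        (\<lambda>n. \<integral>\<omega>. real (collect_time n \<omega>) \<partial>draws n (s n)) \<longlonglongrightarrow>
           real t * exp (- (lam ^ t)) + (real t + 1) * (1 - exp (- (lam ^ t))) \<and>
        (\<exists>D. real_distribution D \<and>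
             measure D {real t} = exp (- (lam ^ t)) \<and>
             measure D {real t + 1} = 1 - exp (- (lam ^ t)) \<and>
             weak_conv_m
               (\<lambda>n. distr (draws n (s n)) borel (\<lambda>\<omega>. real (collect_time n \<omega>))) D))
     \<and>
     (\<forall>s :: nat \<Rightarrow> nat.
        (\<forall>\<^sub>F n in sequentially. 1 \<le> s n \<and> s n < n) \<longrightarrow>
        (\<lambda>n. (real n - real (s n)) / real n powr (real t / (real t + 1))) \<longlonglongrightarrow> 0 \<longrightarrow>
        filterlim (\<lambda>n. (real n - real (s n)) / real n powr ((real t - 1) / real t))
          at_top sequentially \<longrightarrow>
        (\<lambda>n. \<integral>\<omega>. real (collect_time n \<omega>) \<partial>draws n (s n)) \<longlonglongrightarrow> real t + 1 \<and>
        converges_in_prob_const (\<lambda>n. draws n (s n)) (\<lambda>n \<omega>. real (collect_time n \<omega>))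
          (real t + 1))"
proof (intro conjI allI impI)
  fix lam :: real and s :: "nat \<Rightarrow> nat"
  assume lam: "lam > 0"
    and ev: "\<forall>\<^sub>F n in sequentially. 1 \<le> s n \<and> s n < n \<and>
           \<bar>real (s n) - (real n - lam * real n powr ((real t - 1) / real t))\<bar> < 1"
  define \<alpha> where "\<alpha> = (real t - 1) / real t"
  have \<alpha>: "0 < \<alpha>" "\<alpha> < 1" using assms by (auto simp: \<alpha>_def field_simps)
  have bounds: "\<forall>\<^sub>F n in sequentially. 1 \<le> s n \<and> s n < n"
    using ev by eventually_elim simp
  have powr_top: "filterlim (\<lambda>n. real n powr \<beta>) at_top sequentially" if "\<beta> > 0" for \<beta>
  proof (rule filterlim_mono_eventually[OF _ order_refl order_refl])
    have "(\<lambda>n. real n powr - \<beta>) \<longlonglongrightarrow> 0"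
      using that by (intro tendsto_neg_powr filterlim_real_sequentially) auto
    thus "filterlim (\<lambda>n. inverse (real n powr - \<beta>)) at_top sequentially"
      by (rule filterlim_inverse_at_top) (use eventually_gt_at_top[of 0] in \<open>auto elim!: eventually_mono\<close>)
    show "\<forall>\<^sub>F n in sequentially. inverse (real n powr - \<beta>) = real n powr \<beta>"
      by (simp add: powr_minus)
  qed
  \<comment> \<open>Rounding changes \<open>n - s n\<close> by less than 1, which is negligible
    against the diverging \<open>n powr \<alpha>\<close>.\<close>
  have ratio: "(\<lambda>n. real (n - s n) / real n powr \<alpha>) \<longlonglongrightarrow> lam"
  proof (rule LIM_zero_cancel, rule Lim_null_comparison)
    show "(\<lambda>n. inverse (real n powr \<alpha>)) \<longlonglongrightarrow> 0"
      using powr_top[OF \<alpha>(1)] by (rule tendsto_inverse_0_at_top)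
    show "\<forall>\<^sub>F n in sequentially. norm (real (n - s n) / real n powr \<alpha> - lam) \<le> inverse (real n powr \<alpha>)"
      using ev
    proof eventually_elim
      case (elim n)
      hence pos: "real n powr \<alpha> > 0" by simp
      have "real (n - s n) / real n powr \<alpha> - lam = (real (n - s n) - lam * real n powr \<alpha>) / real n powr \<alpha>"
        using pos by (simp add: field_simps)
      also have "norm \<dots> \<le> 1 / real n powr \<alpha>"
        using elim pos unfolding \<alpha>_def[symmetric] real_norm_def abs_divide abs_of_pos[OF pos]
        by (intro divide_right_mono) (auto simp: of_nat_diff)
      finally show ?case by (simp add: inverse_eq_divide)
    qed
  qed
  have m_top: "filterlim (\<lambda>n. real (n - s n)) at_top sequentially"
  proof (rule filterlim_mono_eventually[OF _ order_refl order_refl])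
    show "filterlim (\<lambda>n. real (n - s n) / real n powr \<alpha> * real n powr \<alpha>) at_top sequentially"
      by (rule filterlim_tendsto_pos_mult_at_top[OF ratio lam powr_top[OF \<alpha>(1)]])
    show "\<forall>\<^sub>F n in sequentially. real (n - s n) / real n powr \<alpha> * real n powr \<alpha> = real (n - s n)"
      using eventually_gt_at_top[of 0] by eventually_elim simp
  qed
  have p0: "(\<lambda>n. real (n - s n) / real n) \<longlonglongrightarrow> 0"
  proof (rule Lim_transform_eventually)
    have "(\<lambda>n. real (n - s n) / real n powr \<alpha> * inverse (real n powr (1 - \<alpha>))) \<longlonglongrightarrow> lam * 0"
      using \<alpha> by (intro tendsto_mult ratio tendsto_inverse_0_at_top powr_top) auto
    thus "(\<lambda>n. real (n - s n) / real n powr \<alpha> * inverse (real n powr (1 - \<alpha>))) \<longlonglongrightarrow> 0" by simp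
    show "\<forall>\<^sub>F n in sequentially. real (n - s n) / real n powr \<alpha> * inverse (real n powr (1 - \<alpha>)) = real (n - s n) / real n"
      using eventually_gt_at_top[of 0]
    proof eventually_elim
      case (elim n)
      thus ?case by (simp add: divide_inverse powr_add[symmetric] flip: inverse_mult_distrib mult.assoc)
    qed
  qed
  have mean: "(\<lambda>n. real n * (real (n - s n) / real n) ^ t) \<longlonglongrightarrow> lam ^ t"
  proof (rule Lim_transform_eventually[OF tendsto_power[OF ratio]])
    show "\<forall>\<^sub>F n in sequentially. (real (n - s n) / real n powr \<alpha>) ^ t = real n * (real (n - s n) / real n) ^ t"
      using eventually_gt_at_top[of 0] unfolding \<alpha>_def
      by eventually_elim (rule scaled_power, use assms in auto)
  qed
  interpret threshold s t "exp (- (lam ^ t))"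
  proof
    show "(\<lambda>n. measure (draws n (s n)) (collected n t)) \<longlonglongrightarrow> exp (- (lam ^ t))"
      by (rule prob_collected_poisson_limit[OF _ m_top mean]) (use bounds in \<open>auto elim: eventually_mono\<close>)
    show "(\<lambda>n. real n * (real (n - s n) / real n) ^ (t + 1)) \<longlonglongrightarrow> 0"
      using tendsto_mult[OF mean p0] by (simp add: mult_ac)
    show "filterlim (\<lambda>n. real n * (real (n - s n) / real n) ^ (t - 1)) at_top sequentially"
    proof (rule filterlim_mono_eventually[OF _ order_refl order_refl])
      \<comment> \<open>One draw fewer divides the mean by the ratio. The mean at \<open>t\<close>
        has the positive limit \<open>lam ^ t\<close> and the ratio tends to 0 from above.\<close>
      show "filterlim (\<lambda>n. real n * (real (n - s n) / real n) ^ t * inverse (real (n - s n) / real n))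
          at_top sequentially"
      proof (rule filterlim_tendsto_pos_mult_at_top[OF mean])
        show "filterlim (\<lambda>n. inverse (real (n - s n) / real n)) at_top sequentially"
          by (rule filterlim_inverse_at_top[OF p0]) (use bounds in \<open>auto elim!: eventually_mono\<close>)
      qed (use lam in auto)
      show "\<forall>\<^sub>F n in sequentially. real n * (real (n - s n) / real n) ^ t * inverse (real (n - s n) / real n)
          = real n * (real (n - s n) / real n) ^ (t - 1)"
        using bounds
      proof eventually_elim
        case (elim n)
        hence "real (n - s n) / real n > 0" by simp
        thus ?case using assms
          by (subst power_minus_mult[symmetric, of t "real (n - s n) / real n"]) (auto simp del: of_nat_diff)
      qed
    qed
  qed (use bounds in simp)
  show "(\<lambda>n. \<integral>\<omega>. real (collect_time n \<omega>) \<partial>draws n (s n)) \<longlonglongrightarrow>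
      real t * exp (- (lam ^ t)) + (real t + 1) * (1 - exp (- (lam ^ t)))"
    using expectation_limit by (simp add: algebra_simps)
  show "\<exists>D. real_distribution D \<and>
      measure D {real t} = exp (- (lam ^ t)) \<and>
      measure D {real t + 1} = 1 - exp (- (lam ^ t)) \<and>
      weak_conv_m (\<lambda>n. distr (draws n (s n)) borel (\<lambda>\<omega>. real (collect_time n \<omega>))) D"
    by (rule weak_limit_two_point) (use real_cdf_limit lam in auto)
next
  fix s :: "nat \<Rightarrow> nat"
  assume bounds: "\<forall>\<^sub>F n in sequentially. 1 \<le> s n \<and> s n < n"
    and small: "(\<lambda>n. (real n - real (s n)) / real n powr (real t / (real t + 1))) \<longlonglongrightarrow> 0"
    and large: "filterlim (\<lambda>n. (real n - real (s n)) / real n powr ((real t - 1) / real t))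
      at_top sequentially"
  \<comment> \<open>In the second regime the mean diverges already at \<open>t\<close> draws; hence
    \<open>q = 0\<close> by the second-moment bound, and divergence at \<open>t - 1\<close> draws
    follows because the ratio is at most 1.\<close>
  have mean_top: "filterlim (\<lambda>n. real n * (real (n - s n) / real n) ^ t) at_top sequentially"
  proof (rule filterlim_mono_eventually[OF filterlim_pow_at_top[OF _ large] order_refl order_refl])
    show "\<forall>\<^sub>F n in sequentially. ((real n - real (s n)) / real n powr ((real t - 1) / real t)) ^ t
        = real n * (real (n - s n) / real n) ^ t"
      using bounds
    proof eventually_elim
      case (elim n)
      thus ?case using scaled_power[of n t "real (n - s n)"] assms by (simp add: of_nat_diff)
    qed
  qed (use assms in auto)
  interpret threshold s t 0
  proof
    show "filterlim (\<lambda>n. real n * (real (n - s n) / real n) ^ (t - 1)) at_top sequentially"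
      by (rule filterlim_at_top_mono[OF mean_top])
         (use bounds in \<open>auto elim!: eventually_mono intro!: mult_left_mono power_decreasing\<close>)
    show "(\<lambda>n. real n * (real (n - s n) / real n) ^ (t + 1)) \<longlonglongrightarrow> 0"
    proof (rule Lim_transform_eventually)
      show "(\<lambda>n. ((real n - real (s n)) / real n powr (real t / (real t + 1))) ^ (t + 1)) \<longlonglongrightarrow> 0"
        using tendsto_power[OF small, of "t + 1"] by simp
      show "\<forall>\<^sub>F n in sequentially. ((real n - real (s n)) / real n powr (real t / (real t + 1))) ^ (t + 1)
          = real n * (real (n - s n) / real n) ^ (t + 1)"
        using bounds
      proof eventually_elim
        case (elim n)
        \<comment> \<open>The exponent \<open>t / (t + 1)\<close> is \<open>(k - 1) / k\<close> for
          \<open>k = t + 1\<close>.\<close>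
        thus ?case using scaled_power[of n "t + 1" "real (n - s n)"]
          by (simp add: of_nat_diff add.commute del: power_Suc)
      qed
    qed
    show "(\<lambda>n. measure (draws n (s n)) (collected n t)) \<longlonglongrightarrow> 0"
    proof (rule tendsto_sandwich[OF _ _ tendsto_const])
      show "(\<lambda>n. inverse (real n * (real (n - s n) / real n) ^ t)) \<longlonglongrightarrow> 0"
        using mean_top by (rule tendsto_inverse_0_at_top)
      show "\<forall>\<^sub>F n in sequentially. measure (draws n (s n)) (collected n t) \<le>
          inverse (real n * (real (n - s n) / real n) ^ t)"
        using bounds
      proof eventually_elim
        case (elim n)
        hence "real n * (real (n - s n) / real n) ^ t > 0" by simp
        thus ?case using prob_collected_le[of "s n" n t] elim
          by (simp only: inverse_eq_divide pos_le_divide_eq)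
      qed
    qed auto
  qed (use bounds in simp)
  show "(\<lambda>n. \<integral>\<omega>. real (collect_time n \<omega>) \<partial>draws n (s n)) \<longlonglongrightarrow> real t + 1"
    using expectation_limit by simp
  show "converges_in_prob_const (\<lambda>n. draws n (s n)) (\<lambda>n \<omega>. real (collect_time n \<omega>)) (real t + 1)"
    unfolding converges_in_prob_const_def
  proof (intro allI impI)
    fix \<epsilon> :: real assume \<epsilon>: "\<epsilon> > 0"
    let ?P = "\<lambda>k n. measure (draws n (s n)) {\<omega>. collect_time n \<omega> \<le> k}"
    \<comment> \<open>An integer time that differs from \<open>t + 1\<close> is at most
      \<open>t\<close> or exceeds \<open>t + 1\<close>. The sum of these two probabilities bounds
      the deviation probability for every positive \<epsilon>.\<close>
    have lims: "(\<lambda>n. ?P t n + (1 - ?P (t + 1) n)) \<longlonglongrightarrow> 0"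
      using tendsto_add[OF prob_collect_time_limit[of t]
        tendsto_diff[OF tendsto_const[of 1] prob_collect_time_limit[of "t + 1"]]]
      by (simp add: limit_cdf_def)
    show "(\<lambda>n. measure (draws n (s n)) {\<omega> \<in> space (draws n (s n)).
        \<bar>real (collect_time n \<omega>) - (real t + 1)\<bar> > \<epsilon>}) \<longlonglongrightarrow> 0"
    proof (rule tendsto_sandwich[OF _ _ tendsto_const lims])
      have "measure (draws n (s n)) {\<omega> \<in> space (draws n (s n)).
          \<bar>real (collect_time n \<omega>) - (real t + 1)\<bar> > \<epsilon>} \<le> ?P t n + (1 - ?P (t + 1) n)" for n
      proof -
        interpret prob_space "draws n (s n)" by (rule prob_space_draws)
        have meas: "{\<omega>. collect_time n \<omega> \<le> k} \<in> events" for k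
          using measurable_sets[OF measurable_collect_time, of "{..k}" n n "s n"] by (simp add: vimage_def)
        have "prob {\<omega> \<in> space (draws n (s n)). \<bar>real (collect_time n \<omega>) - (real t + 1)\<bar> > \<epsilon>}
            \<le> prob ({\<omega>. collect_time n \<omega> \<le> t} \<union> (space (draws n (s n)) - {\<omega>. collect_time n \<omega> \<le> t + 1}))"
        proof (rule finite_measure_mono)
          show "{\<omega> \<in> space (draws n (s n)). \<bar>real (collect_time n \<omega>) - (real t + 1)\<bar> > \<epsilon>}
            \<subseteq> {\<omega>. collect_time n \<omega> \<le> t} \<union> (space (draws n (s n)) - {\<omega>. collect_time n \<omega> \<le> t + 1})"
          proof safe
            fix \<omega> assume *: "\<bar>real (collect_time n \<omega>) - (real t + 1)\<bar> > \<epsilon>"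
              "\<not> collect_time n \<omega> \<le> t" "collect_time n \<omega> \<le> t + 1"
            hence "collect_time n \<omega> = t + 1" by linarith
            thus False using * \<epsilon> by simp
          qed
        qed (intro sets.Un sets.Diff meas sets.top)
        also have "\<dots> \<le> ?P t n + prob (space (draws n (s n)) - {\<omega>. collect_time n \<omega> \<le> t + 1})"
          by (intro measure_Un_le sets.Diff meas sets.top)
        also have "prob (space (draws n (s n)) - {\<omega>. collect_time n \<omega> \<le> t + 1}) = 1 - ?P (t + 1) n"
          by (rule prob_compl) (rule meas)
        finally show ?thesis .
      qed
      thus "\<forall>\<^sub>F n in sequentially. measure (draws n (s n)) {\<omega> \<in> space (draws n (s n)).
          \<bar>real (collect_time n \<omega>) - (real t + 1)\<bar> > \<epsilon>} \<le> ?P t n + (1 - ?P (t + 1) n)" by simp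
    qed simp
  qed
qed

end
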